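(* Let $\rho:[0,\infty)\to[0,\infty)$ be concave and monotonically increasing with $\rho(0)=0$, with all subgradients on $[0,\infty)$ finite, and with $\kappa:=\lim_{x\to 0^+}\sup_{w\in\partial\rho(x)} w<+\infty$. Let $\mathcal{A}:\mathcal{S}^n\to\mathbb{R}^m$ be linear, $b\in\mathbb{R}^m$, and let $\phi:\mathcal{S}^n\to\mathbb{R}$ be an $L$-smooth function. Let $G(W)=\sum_{i=1}^n g(\lambda_i(W))$ for $W\in\mathcal{S}^n_+$, where $g$ is a convex function satisfying $$\partial g(w)=\{-x \,:\, x\ge 0,\ w\in\partial\rho(x)\}\qquad (0\le w\le\kappa).$$ Consider the problem $$(\mathrm{P})\qquad \min_{X\in\mathcal{S}^n}\ \sum_{i=1}^n\rho(\lambda_i(X))+\phi(X)\quad\text{subject to}\quad \mathcal{A}(X)=b,\ X\succeq 0,$$ and the bi-convex semidefinite program $$(\mathrm{B})\qquad \min_{X,W\in\mathcal{S}^n}\ \langle X,W\rangle+G(W)+\phi(X)\quad\text{subject to}\quad \mathcal{A}(X)=b,\ X\succeq 0,\ \kappa I\succeq W\succeq 0.$$ Then any KKT point $X^*$ of $(\mathrm{P})$ can be used to construct a KKT point $(X^*,W^* )$ of $(\mathrm{B})$ with $W^*\in\partial\rho(X^* )$. Likewise, for any pair $(X^*,W^* )$ that is a KKT point of $(\mathrm{B})$, $X^*$ is a KKT point of $(\mathrm{P})$ and $W^*\in\partial\rho(X^* )$.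
   Context: $\mathcal{S}^n$ is the space of real symmetric $n\times n$ matrices with inner product $\langle A,B\rangle=\mathrm{trace}(AB)$; $\mathcal{S}^n_+$ is the cone of positive semidefinite matrices; $\lambda_i(X)$ is the $i$-th eigenvalue of $X$. "Monotonically increasing" means nondecreasing. Write $\mathcal{A}(X)_i=\langle A_i,X\rangle$ with $A_i\in\mathcal{S}^n$. For the concave function $\rho$ and $x>0$, $\partial\rho(x)=\{w:\rho(y)\le\rho(x)+w(y-x)\ \forall y\ge 0\}$. At $x=0$ the convention used here is $\kappa=\sup\partial\rho(0)$, so that $\partial\rho(0)=\{\kappa\}$. For the convex function $g$, which is allowed to take the value $+\infty$ (for instance at $0$), $\partial g$ is the usual convex subdifferential. For $X\in\mathcal{S}^n_+$, $\partial\rho(X)$ is the set of matrices $V\,\mathrm{diag}(y_1,\dots,y_n)V^T$ with $V$ an orthogonal matrix of eigenvectors of $X$ (the $i$-th column corresponding to $\lambda_i(X)$) and $y_i\in\partial\rho(\lambda_i(X))$. Similarly, $\partial G(W)$ is the set of matrices $V\,\mathrm{diag}(z_1,\dots,z_n)V^T$ with $V$ an orthogonal matrix of eigenvectors of $W$ and $z_i\in\partial g(\lambda_i(W))$. For symmetric matrices, $0\preceq A\perp B\succeq 0$ means $A\succeq0$, $B\succeq0$, $\langle A,B\rangle=0$. KKT point of $(\mathrm{P})$: $X$ with $\mathcal{A}(X)=b$ for which there exist $U\in\partial\rho(X)$ and $\mu\in\mathbb{R}^m$ with $0\preceq X\perp\sum_i\mu_iA_i+U+\nabla\phi(X)\succeq0$.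 KKT point of $(\mathrm{B})$: a pair $(X,W)$ with $\mathcal{A}(X)=b$ for which there exist $Z\in\partial G(W)$, $Y\in\mathcal{S}^n$ and $\mu\in\mathbb{R}^m$ with $0\preceq W\perp X+Z+Y\succeq0$, $\ 0\preceq X\perp\sum_i\mu_iA_i+W+\nabla\phi(X)\succeq0$, and $0\preceq Y\perp\kappa I-W\succeq0$. *)

theory Defs
  imports "HOL-Analysis.Analysis"
begin

section \<open>Symmetric and positive semidefinite matrices\<close>

definition sym_mats :: "(real^'n^'n) set" where
  "sym_mats = {X. transpose X = X}"

text \<open>The library inner product on matrices is the entrywise one; on symmetric
  matrices it is the trace inner product, and the library norm is the Frobenius norm.\<close>

lemma inner_eq_trace:
  fixes A B :: "real^'n^'n"
  assumes "A \<in> sym_mats"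
  shows "A \<bullet> B = trace (A ** B)"
proof -
  have sym: "A $ i $ j = A $ j $ i" for i j
    using assms by (metis (mono_tags, lifting) mem_Collect_eq sym_mats_def transpose_def vec_lambda_beta)
  have "A \<bullet> B = (\<Sum>i\<in>UNIV. \<Sum>j\<in>UNIV. A $ i $ j * B $ i $ j)"
    by (simp add: inner_vec_def)
  also have "\<dots> = (\<Sum>j\<in>UNIV. \<Sum>i\<in>UNIV. A $ i $ j * B $ i $ j)"
    by (rule sum.swap)
  also have "\<dots> = (\<Sum>j\<in>UNIV. \<Sum>i\<in>UNIV. A $ j $ i * B $ i $ j)"
    by (simp only: sym)
  also have "\<dots> = trace (A ** B)"
    by (simp add: trace_def matrix_matrix_mult_def)
  finally show ?thesis .
qed

definition psd :: "real^'n^'n \<Rightarrow> bool" where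
  "psd A \<longleftrightarrow> A \<in> sym_mats \<and> (\<forall>x. 0 \<le> x \<bullet> (A *v x))"

text \<open>\<open>psd_compl A B\<close> stands for \<open>0 \<preceq> A \<bottom> B \<succeq> 0\<close>.\<close>

definition psd_compl :: "real^'n^'n \<Rightarrow> real^'n^'n \<Rightarrow> bool" where
  "psd_compl A B \<longleftrightarrow> psd A \<and> psd B \<and> A \<bullet> B = 0"

section \<open>Spectral subdifferentials\<close>

definition diag_mat :: "real^'n \<Rightarrow> real^'n^'n" where
  "diag_mat d = (\<chi> i j. if i = j then d $ i else 0)"

text \<open>\<open>V\<close> is an orthogonal matrix of eigenvectors of \<open>X\<close>, the column \<open>i\<close> belonging to
  the eigenvalue \<open>l $ i\<close>. Since \<open>V\<close> is orthogonal, \<open>l\<close> lists all eigenvalues of \<open>X\<close> with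
  multiplicity. No order is imposed on this list: permuting the columns of \<open>V\<close>
  along with \<open>l\<close> does not change the set \<open>spectral_set S X\<close> below.\<close>

definition eigensystem :: "real^'n^'n \<Rightarrow> real^'n^'n \<Rightarrow> real^'n \<Rightarrow> bool" where
  "eigensystem X V l \<longleftrightarrow>
     orthogonal_matrix V \<and> (\<forall>i. X *v column i V = (l $ i) *\<^sub>R column i V)"

definition spectral_set :: "(real \<Rightarrow> real set) \<Rightarrow> real^'n^'n \<Rightarrow> (real^'n^'n) set" where
  "spectral_set S X =
     {V ** diag_mat y ** transpose V | V y. \<exists>l. eigensystem X V l \<and> (\<forall>i. y $ i \<in> S (l $ i))}"

text \<open>The superdifferential of a concave function on \<open>[0, \<infinity>)\<close>. At \<open>0\<close> this
  set is upward closed, and \<open>subdiff_rho\<close> replaces it by the conventional \<open>{\<kappa>}\<close>.\<close>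

definition superdiff :: "(real \<Rightarrow> real) \<Rightarrow> real \<Rightarrow> real set" where
  "superdiff \<rho> x = {w. \<forall>y\<ge>0. \<rho> y \<le> \<rho> x + w * (y - x)}"

definition subdiff_rho :: "(real \<Rightarrow> real) \<Rightarrow> real \<Rightarrow> real \<Rightarrow> real set" where
  "subdiff_rho \<rho> \<kappa> x = (if x = 0 then {\<kappa>} else superdiff \<rho> x)"

definition subdiff_rho_mat :: "(real \<Rightarrow> real) \<Rightarrow> real \<Rightarrow> real^'n^'n \<Rightarrow> (real^'n^'n) set" where
  "subdiff_rho_mat \<rho> \<kappa> X = spectral_set (subdiff_rho \<rho> \<kappa>) X"

text \<open>Convex functions with values in \<open>(-\<infinity>, \<infinity>]\<close>; the subdifferential is empty where the
  function is \<open>\<infinity>\<close>. A function given only on \<open>[0, \<infinity>)\<close> is understood to be \<open>\<infinity>\<close> on the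
  negative reals, which affects neither convexity nor the subdifferential on \<open>[0, \<infinity>)\<close>.\<close>

definition convex_ereal :: "(real \<Rightarrow> ereal) \<Rightarrow> bool" where
  "convex_ereal g \<longleftrightarrow> (\<forall>x. g x \<noteq> -\<infinity>) \<and>
     (\<forall>x y t. 0 < t \<and> t < 1 \<longrightarrow>
        g ((1 - t) * x + t * y) \<le> ereal (1 - t) * g x + ereal t * g y)"

definition subdiff :: "(real \<Rightarrow> ereal) \<Rightarrow> real \<Rightarrow> real set" where
  "subdiff g w = {z. g w \<noteq> \<infinity> \<and> (\<forall>v. g w + ereal (z * (v - w)) \<le> g v)}"

text \<open>The set \<open>\<partial>G(W)\<close> for \<open>G(W) = \<Sum>i. g (\<lambda>\<^sub>i(W))\<close>.\<close>

definition subdiff_G :: "(real \<Rightarrow> ereal) \<Rightarrow> real^'n^'n \<Rightarrow> (real^'n^'n) set" where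
  "subdiff_G g W = spectral_set (subdiff g) W"

section \<open>Smooth functions on the space of symmetric matrices\<close>

text \<open>Only the values of \<open>\<phi>\<close> on \<open>sym_mats\<close> matter: the derivative is taken within this
  subspace, and the gradient is the element of the subspace representing it.\<close>

definition is_sym_grad :: "(real^'n^'n \<Rightarrow> real) \<Rightarrow> real^'n^'n \<Rightarrow> real^'n^'n \<Rightarrow> bool" where
  "is_sym_grad \<phi> X D \<longleftrightarrow>
     D \<in> sym_mats \<and> (\<phi> has_derivative (\<lambda>H. D \<bullet> H)) (at X within sym_mats)"

lemma is_sym_grad_unique:
  assumes X: "X \<in> sym_mats" and D: "is_sym_grad \<phi> X D" and E: "is_sym_grad \<phi> X E"
  shows "D = E"
proof -
  define H where "H = D - E"
  have tr: "transpose (A + t *\<^sub>R B) = A + t *\<^sub>R B"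
    if "transpose A = A" "transpose B = B" for A B :: "real^'n^'n" and t
    using that by (simp add: transpose_def vec_eq_iff)
  have H: "H \<in> sym_mats"
    using tr[of D E "-1"] D E unfolding H_def is_sym_grad_def sym_mats_def by simp
  have line: "X + t *\<^sub>R H \<in> sym_mats" for t
    using X H tr unfolding sym_mats_def by simp
  have dir: "((\<lambda>t. \<phi> (X + t *\<^sub>R H)) has_derivative (\<lambda>t. F \<bullet> (t *\<^sub>R H))) (at 0)"
    if F: "is_sym_grad \<phi> X F" for F
  proof -
    have 1: "((\<lambda>t. X + t *\<^sub>R H) has_derivative (\<lambda>t. t *\<^sub>R H)) (at 0)"
      by (auto intro!: derivative_eq_intros)
    have "(\<phi> has_derivative (\<lambda>K. F \<bullet> K)) (at (X + 0 *\<^sub>R H) within range (\<lambda>t. X + t *\<^sub>R H))"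
      using F line unfolding is_sym_grad_def by (auto intro: has_derivative_subset)
    from has_derivative_in_compose[OF 1 this] show ?thesis .
  qed
  have "(\<lambda>t. D \<bullet> (t *\<^sub>R H)) = (\<lambda>t. E \<bullet> (t *\<^sub>R H))"
    using has_derivative_unique[OF dir[OF D] dir[OF E]] .
  then have "D \<bullet> (1 *\<^sub>R H) = E \<bullet> (1 *\<^sub>R H)"
    by meson
  then have "H \<bullet> H = 0"
    by (simp add: H_def inner_diff_left)
  then show ?thesis
    by (simp add: H_def)
qed

definition sym_grad :: "(real^'n^'n \<Rightarrow> real) \<Rightarrow> real^'n^'n \<Rightarrow> real^'n^'n" where
  "sym_grad \<phi> X = (THE D. is_sym_grad \<phi> X D)"

lemma sym_grad_eq:
  assumes "X \<in> sym_mats" "is_sym_grad \<phi> X D"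
  shows "sym_grad \<phi> X = D"
  unfolding sym_grad_def using assms is_sym_grad_unique by blast

definition L_smooth :: "real \<Rightarrow> (real^'n^'n \<Rightarrow> real) \<Rightarrow> bool" where
  "L_smooth L \<phi> \<longleftrightarrow>
     (\<forall>X\<in>sym_mats. \<exists>D. is_sym_grad \<phi> X D) \<and> L-lipschitz_on sym_mats (sym_grad \<phi>)"

section \<open>KKT points\<close>

definition kkt_P ::
  "(real \<Rightarrow> real) \<Rightarrow> real \<Rightarrow> (real^'n^'n \<Rightarrow> real^'m) \<Rightarrow> ('m \<Rightarrow> real^'n^'n) \<Rightarrow> real^'m \<Rightarrow>
   (real^'n^'n \<Rightarrow> real) \<Rightarrow> real^'n^'n \<Rightarrow> bool" where
  "kkt_P \<rho> \<kappa> \<A> A b \<phi> X \<longleftrightarrow>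
     X \<in> sym_mats \<and> \<A> X = b \<and>
     (\<exists>U \<mu>. U \<in> subdiff_rho_mat \<rho> \<kappa> X \<and>
        psd_compl X ((\<Sum>i\<in>UNIV. (\<mu> :: real^'m) $ i *\<^sub>R A i) + U + sym_grad \<phi> X))"

definition kkt_B ::
  "(real \<Rightarrow> ereal) \<Rightarrow> real \<Rightarrow> (real^'n^'n \<Rightarrow> real^'m) \<Rightarrow> ('m \<Rightarrow> real^'n^'n) \<Rightarrow> real^'m \<Rightarrow>
   (real^'n^'n \<Rightarrow> real) \<Rightarrow> real^'n^'n \<Rightarrow> real^'n^'n \<Rightarrow> bool" where
  "kkt_B g \<kappa> \<A> A b \<phi> X W \<longleftrightarrow>
     X \<in> sym_mats \<and> W \<in> sym_mats \<and> \<A> X = b \<and>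
     (\<exists>Z Y \<mu>. Z \<in> subdiff_G g W \<and> Y \<in> sym_mats \<and>
        psd_compl W (X + Z + Y) \<and>
        psd_compl X ((\<Sum>i\<in>UNIV. (\<mu> :: real^'m) $ i *\<^sub>R A i) + W + sym_grad \<phi> X) \<and>
        psd_compl Y (mat \<kappa> - W))"

end

theory Submission
  imports Defs
begin

text \<open>
  From a KKT point \<open>X\<close> of (P) with \<open>U \<in> \<partial>\<rho>(X)\<close> one obtains a KKT point of (B) by
  \<open>W = U\<close>, \<open>Z = -X\<close>, \<open>Y = 0\<close>. Conversely, put \<open>M = X + Z + Y\<close>. Complementarity gives
  \<open>W M = 0\<close> and \<open>Y W = \<kappa> Y\<close>, so \<open>X = M - Z - Y\<close> commutes with \<open>W\<close>, and both matrices
  share an orthonormal eigenbasis. On a common eigenvector with eigenvalues \<open>l\<close> of \<open>X\<close> and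
  \<open>w\<close> of \<open>W\<close>, this reads \<open>l = d + m - y\<close>, where \<open>d\<close> is a convex combination of points \<open>x\<close> with
  \<open>w \<in> \<partial>\<rho>(x)\<close>, and \<open>m, y \<ge> 0\<close> vanish unless \<open>w = 0\<close> and \<open>w = \<kappa>\<close> respectively. The set of
  \<open>x \<ge> 0\<close> with \<open>w \<in> \<partial>\<rho>(x)\<close> is an interval, unbounded above if \<open>w = 0\<close> and containing \<open>0\<close> if
  \<open>w = \<kappa>\<close>. Hence it contains \<open>l\<close>.
\<close>

section \<open>Superdifferentials\<close>

text \<open>Testing each supergradient inequality at the other point and adding the two cancels the
  values of \<open>\<rho>\<close>.\<close>

lemma superdiff_antimono:
  assumes "w \<in> superdiff \<rho> x" "w' \<in> superdiff \<rho> t" "0 \<le> t" "t < x"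
  shows "w \<le> w'"
proof -
  have "\<rho> t \<le> \<rho> x + w * (t - x)" "\<rho> x \<le> \<rho> t + w' * (x - t)"
    using assms by (auto simp: superdiff_def)
  then have "w * (x - t) \<le> w' * (x - t)"
    by (simp add: algebra_simps)
  then show ?thesis
    using assms by simp
qed

text \<open>These points are the maximizers of the concave function \<open>\<rho> z - w * z\<close>
  over \<open>z \<ge> 0\<close>, and such maximizers form a convex set.\<close>

lemma convex_superdiff_points:
  assumes "concave_on {0..} \<rho>"
  shows "convex {x. 0 \<le> x \<and> w \<in> superdiff \<rho> x}"
proof (rule convexI)
  fix x y u v :: real
  assume "x \<in> {x. 0 \<le> x \<and> w \<in> superdiff \<rho> x}" "y \<in> {x. 0 \<le> x \<and> w \<in> superdiff \<rho> x}"
    and uv: "0 \<le> u" "0 \<le> v" "u + v = 1"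
  then have x: "0 \<le> x" "\<forall>z\<ge>0. \<rho> z \<le> \<rho> x + w * (z - x)"
    and y: "0 \<le> y" "\<forall>z\<ge>0. \<rho> z \<le> \<rho> y + w * (z - y)"
    by (auto simp: superdiff_def)
  have "0 \<le> u * x + v * y \<and> (\<forall>z\<ge>0. \<rho> z \<le> \<rho> (u * x + v * y) + w * (z - (u * x + v * y)))"
  proof (intro conjI allI impI)
    show "0 \<le> u * x + v * y"
      using x y uv by simp
  next
    fix z :: real assume z: "0 \<le> z"
    have J: "u * \<rho> x + v * \<rho> y \<le> \<rho> (u * x + v * y)"
      using assms x y uv unfolding concave_on_iff by simp
    have "u * \<rho> z + v * \<rho> z \<le> u * (\<rho> x + w * (z - x)) + v * (\<rho> y + w * (z - y))"
      using x y uv z by (intro add_mono mult_left_mono) auto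
    also have "\<dots> = u * \<rho> x + v * \<rho> y + w * ((u + v) * z - (u * x + v * y))"
      by (simp add: algebra_simps)
    finally show "\<rho> z \<le> \<rho> (u * x + v * y) + w * (z - (u * x + v * y))"
      using J uv by (simp flip: distrib_right)
  qed
  then show "u *\<^sub>R x + v *\<^sub>R y \<in> {x. 0 \<le> x \<and> w \<in> superdiff \<rho> x}"
    by (simp add: superdiff_def)
qed

section \<open>Bounds on supergradients and the extreme slopes \<open>0\<close> and
  \<open>\<kappa>\<close>\<close>

context
  fixes \<rho> :: "real \<Rightarrow> real" and \<kappa> :: real
  assumes nonneg: "\<And>x. x \<ge> 0 \<Longrightarrow> \<rho> x \<ge> 0"
    and mono: "mono_on {0..} \<rho>"
    and zero: "\<rho> 0 = 0"
    and superdiff_nonempty: "\<And>x. x \<ge> 0 \<Longrightarrow> superdiff \<rho> x \<noteq> {}"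
    and lim: "((\<lambda>x. Sup (superdiff \<rho> x)) \<longlongrightarrow> \<kappa>) (at_right 0)"
begin

lemma superdiff_ge_0:
  assumes "0 \<le> x" "w \<in> superdiff \<rho> x"
  shows "0 \<le> w"
proof -
  have "\<rho> x \<le> \<rho> (x + 1)"
    using mono assms by (auto intro: mono_onD)
  moreover have "\<rho> (x + 1) \<le> \<rho> x + w * (x + 1 - x)"
    using assms unfolding superdiff_def by (metis (lifting) add_nonneg_nonneg mem_Collect_eq zero_le_one)
  ultimately show ?thesis
    by simp
qed

text \<open>By antitonicity \<open>w\<close> lies below all supergradients at points
  \<open>t < x\<close>, hence below their suprema; then \<open>t\<close> tends to
  \<open>0\<close>.\<close>

lemma superdiff_le_kappa:
  assumes "0 < x" "w \<in> superdiff \<rho> x"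
  shows "w \<le> \<kappa>"
proof (rule tendsto_lowerbound[OF lim])
  have "w \<le> Sup (superdiff \<rho> t)" if t: "0 < t" "t < x" for t
  proof -
    obtain w' where w': "w' \<in> superdiff \<rho> t"
      using superdiff_nonempty[of t] t by auto
    \<comment> \<open>The real \<open>Sup\<close> is an upper bound only for a set bounded above;
      testing at \<open>0\<close>, where \<open>\<rho>\<close> vanishes, supplies the bound.\<close>
    have "u \<le> \<rho> t / t" if "u \<in> superdiff \<rho> t" for u
    proof -
      have "\<rho> 0 \<le> \<rho> t + u * (0 - t)"
        using that unfolding superdiff_def by blast
      then show ?thesis
        using t zero by (simp add: field_simps)
    qed
    then have "bdd_above (superdiff \<rho> t)"
      by (rule bdd_aboveI)
    then have "w' \<le> Sup (superdiff \<rho> t)"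
      using w' by (intro cSup_upper)
    then show ?thesis
      using superdiff_antimono[OF assms(2) w'] t by simp
  qed
  then show "\<forall>\<^sub>F t in at_right 0. w \<le> Sup (superdiff \<rho> t)"
    using assms(1) unfolding eventually_at_right_field by blast
qed simp

lemma kappa_ge_0: "0 \<le> \<kappa>"
  using superdiff_nonempty[of 1] superdiff_ge_0[of 1] superdiff_le_kappa[of 1]
  by fastforce

lemma superdiff_0_ge_kappa:
  assumes "w \<in> superdiff \<rho> 0"
  shows "\<kappa> \<le> w"
proof (rule tendsto_upperbound[OF lim])
  have "Sup (superdiff \<rho> t) \<le> w" if "0 < t" for t
    using superdiff_antimono[OF _ assms] superdiff_nonempty[of t] that
    by (intro cSup_least) auto
  then show "\<forall>\<^sub>F t in at_right 0. Sup (superdiff \<rho> t) \<le> w"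
    by (auto simp: eventually_at_right_field intro: exI[of _ 1])
qed simp

text \<open>For small \<open>t > 0\<close> the tangent line at \<open>t\<close> has slope at most
  \<open>\<kappa>\<close>. Letting \<open>t\<close> tend to \<open>0\<close> needs
  \<open>\<rho> t\<close> to vanish in the limit, which any finite supergradient \<open>w\<close> at
  \<open>0\<close> ensures through \<open>\<rho> t \<le> w * t\<close>.\<close>

lemma kappa_in_superdiff_0: "\<kappa> \<in> superdiff \<rho> 0"
proof -
  obtain w where w: "w \<in> superdiff \<rho> 0"
    using superdiff_nonempty[of 0] by auto
  have "\<rho> y \<le> \<kappa> * y" if y: "0 < y" for y
  proof -
    have "\<rho> y \<le> w * t + \<kappa> * y" if t: "0 < t" "t < y" for t
    proof -
      obtain w' where w': "w' \<in> superdiff \<rho> t"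
        using superdiff_nonempty[of t] t by auto
      have "\<rho> y \<le> \<rho> t + w' * (y - t)"
        using w' y by (auto simp: superdiff_def)
      also have "\<dots> \<le> w * t + \<kappa> * y"
      proof (rule add_mono)
        show "\<rho> t \<le> w * t"
          using w t zero by (auto simp: superdiff_def)
        show "w' * (y - t) \<le> \<kappa> * y"
          using superdiff_le_kappa[OF t(1) w'] kappa_ge_0 t by (intro mult_mono) auto
      qed
      finally show ?thesis .
    qed
    then have "\<forall>\<^sub>F t in at_right 0. \<rho> y \<le> w * t + \<kappa> * y"
      using y unfolding eventually_at_right_field by blast
    moreover have "((\<lambda>t. w * t + \<kappa> * y) \<longlongrightarrow> w * 0 + \<kappa> * y) (at_right 0)"
      by (intro tendsto_intros)
    ultimately show ?thesis
      using tendsto_lowerbound by fastforce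
  qed
  then show ?thesis
    using zero by (auto simp: superdiff_def order_le_less)
qed

lemma subdiff_rho_bounds:
  assumes "0 \<le> x" "w \<in> subdiff_rho \<rho> \<kappa> x"
  shows "0 \<le> w" "w \<le> \<kappa>"
  using assms superdiff_ge_0[of x w] superdiff_le_kappa[of x w] kappa_ge_0
  by (auto simp: subdiff_rho_def split: if_splits)

text \<open>At \<open>0\<close> the superdifferential contains \<open>\<kappa>\<close> and lies in
  \<open>[\<kappa>, \<infinity>)\<close>, so below \<open>\<kappa>\<close> the convention at
  \<open>0\<close> makes no difference. This allows uniform work with
  \<open>superdiff\<close>.\<close>

lemma subdiff_rho_iff_superdiff:
  assumes "w \<le> \<kappa>"
  shows "w \<in> subdiff_rho \<rho> \<kappa> x \<longleftrightarrow> w \<in> superdiff \<rho> x"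
  using kappa_in_superdiff_0 superdiff_0_ge_kappa[of w] assms
  by (auto simp: subdiff_rho_def)

text \<open>Slope \<open>0\<close> means that \<open>x\<close> maximizes \<open>\<rho>\<close>, and
  monotonicity passes this on to every larger point.\<close>

lemma zero_in_superdiff_up:
  assumes "0 \<in> superdiff \<rho> x" "0 \<le> x" "x \<le> x'"
  shows "0 \<in> superdiff \<rho> x'"
proof -
  have "\<rho> x \<le> \<rho> x'"
    using mono assms by (auto intro: mono_onD)
  then show ?thesis
    using assms by (force simp: superdiff_def)
qed

text \<open>The points with supergradient \<open>\<kappa>\<close> form an interval, and it contains
  \<open>0\<close>.\<close>

lemma kappa_in_superdiff_down:
  assumes "concave_on {0..} \<rho>" "\<kappa> \<in> superdiff \<rho> x" "0 \<le> x'" "x' \<le> x"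
  shows "\<kappa> \<in> superdiff \<rho> x'"
proof -
  have "is_interval {x. 0 \<le> x \<and> \<kappa> \<in> superdiff \<rho> x}"
    using convex_superdiff_points[OF assms(1)] by (simp add: is_interval_convex_1)
  from mem_is_interval_1_I[OF this, of 0 x x'] show ?thesis
    using kappa_in_superdiff_0 assms(2-) by simp
qed

end

section \<open>Common eigenbases of commuting symmetric matrices\<close>

lemma transpose_dot:
  fixes A :: "real^'n^'m"
  shows "(transpose A *v x) \<bullet> y = x \<bullet> (A *v y)"
  by (simp add: dot_lmul_matrix)

lemma sym_dot:
  assumes "A \<in> sym_mats"
  shows "(A *v x) \<bullet> y = x \<bullet> (A *v y)"
  by (metis (mono_tags, lifting) assms mem_Collect_eq sym_mats_def transpose_dot)

lemma mat_mult_vec: "mat k *v x = k *\<^sub>R (x :: real^'n)"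
  by (simp add: mat_def matrix_vector_mult_def vec_eq_iff if_distrib[of "\<lambda>c. c * _"] cong: if_cong)

text \<open>At \<open>v\<close> the form attains its minimum \<open>0\<close> over \<open>S\<close>,
  so its derivative in the direction \<open>B *v v\<close>, which stays in \<open>S\<close>, must
  vanish. The version on a subspace serves the Rayleigh quotient argument below.\<close>

lemma psd_on_form_eq_0:
  fixes B :: "real^'n^'n"
  assumes sym: "B \<in> sym_mats" and S: "subspace S" and inv: "\<And>x. x \<in> S \<Longrightarrow> B *v x \<in> S"
    and nonneg: "\<And>x. x \<in> S \<Longrightarrow> 0 \<le> x \<bullet> (B *v x)"
    and v: "v \<in> S" "v \<bullet> (B *v v) = 0"
  shows "B *v v = 0"
proof -
  define y where "y = B *v v"
  define a where "a = y \<bullet> y"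
  define c where "c = y \<bullet> (B *v y)"
  have y: "y \<in> S" "0 \<le> c"
    using inv v nonneg by (auto simp: y_def c_def)
  \<comment> \<open>Near the minimizing step \<open>- a / c\<close>; the added \<open>1\<close>
    keeps the denominator positive when \<open>c = 0\<close>, and the form stays negative unless
    \<open>a = 0\<close>.\<close>
  define t where "t = - a / (c + 1)"
  have "v + t *\<^sub>R y \<in> S"
    using S v y by (simp add: subspace_add subspace_scale)
  from nonneg[OF this] have "0 \<le> 2 * t * a + t\<^sup>2 * c"
    using v sym_dot[OF sym, of v y]
    by (simp add: matrix_vector_right_distrib matrix_vector_mult_scaleR inner_add_left inner_add_right
        c_def a_def y_def[symmetric] inner_commute power2_eq_square algebra_simps)
  also have "2 * t * a + t\<^sup>2 * c = - (a\<^sup>2 * (c + 2) / (c + 1)\<^sup>2)"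
    using y by (simp add: t_def divide_simps power2_eq_square) (simp add: algebra_simps)
  finally have "a\<^sup>2 * (c + 2) / (c + 1)\<^sup>2 \<le> 0"
    by simp
  then have "a\<^sup>2 * (c + 2) \<le> 0"
    using y by (simp add: divide_le_0_iff)
  then have "a = 0"
    using y by (simp add: mult_le_0_iff)
  then show ?thesis
    by (simp add: a_def y_def)
qed

text \<open>The Rayleigh quotient attains its maximum \<open>l\<close> on the unit sphere of
  \<open>S\<close> at some \<open>v\<close>. Then \<open>mat l - A\<close> has a nonnegative form on
  \<open>S\<close> that vanishes at \<open>v\<close>, so it annihilates \<open>v\<close>.\<close>

lemma sym_eigenvector:
  fixes A :: "real^'n^'n"
  assumes sym: "A \<in> sym_mats" and S: "subspace S" and inv: "\<And>x. x \<in> S \<Longrightarrow> A *v x \<in> S"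
    and ne: "S \<noteq> {0}"
  obtains v l where "v \<in> S" "norm v = 1" "A *v v = l *\<^sub>R v"
proof -
  obtain u where u: "u \<in> S" "u \<noteq> 0"
    using ne subspace_0[OF S] by auto
  define K where "K = S \<inter> sphere 0 1"
  have scaled: "(1 / norm x) *\<^sub>R x \<in> K" if "x \<in> S" "x \<noteq> 0" for x
    using that S by (auto simp: K_def subspace_scale)
  have "compact K"
    unfolding K_def by (intro closed_Int_compact closed_subspace S compact_sphere)
  moreover have "K \<noteq> {}"
    using scaled[OF u] by auto
  moreover have "continuous_on K (\<lambda>x. x \<bullet> (A *v x))"
    by (intro continuous_intros matrix_vector_mult_linear_continuous_on)
  ultimately obtain v where v: "v \<in> K" and max: "\<And>x. x \<in> K \<Longrightarrow> x \<bullet> (A *v x) \<le> v \<bullet> (A *v v)"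
    using continuous_attains_sup[of K "\<lambda>x. x \<bullet> (A *v x)"] by blast
  define l where "l = v \<bullet> (A *v v)"
  define B where "B = mat l - A"
  have B: "B *v x = l *\<^sub>R x - A *v x" for x
    by (simp add: B_def matrix_vector_mult_diff_rdistrib mat_mult_vec)
  have v': "v \<in> S" "norm v = 1"
    using v by (auto simp: K_def)
  have "B *v v = 0"
  proof (rule psd_on_form_eq_0[OF _ S])
    show "B \<in> sym_mats"
      using sym by (simp add: B_def sym_mats_def transpose_def vec_eq_iff mat_def)
    show "B *v x \<in> S" if "x \<in> S" for x
      using that S inv by (simp add: B subspace_diff subspace_scale)
    show "0 \<le> x \<bullet> (B *v x)" if x: "x \<in> S" for x
    proof (cases "x = 0")
      case False
      have "x \<bullet> (A *v x) / (norm x)\<^sup>2 \<le> l"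
        using max[OF scaled[OF x False]]
        by (simp add: l_def matrix_vector_mult_scaleR power2_eq_square)
      then show ?thesis
        using False by (simp add: B inner_diff_right field_simps dot_square_norm)
    qed simp
    show "v \<in> S" by fact
    show "v \<bullet> (B *v v) = 0"
      using v' by (simp add: B inner_diff_right l_def dot_square_norm)
  qed
  then show ?thesis
    using that[of v l] v' by (simp add: B)
qed

text \<open>By commutation, \<open>B\<close> preserves the eigenspaces of \<open>A\<close> within
  \<open>S\<close>, so an eigenvector of \<open>B\<close> can be sought inside one of them.\<close>

lemma common_eigenvector:
  fixes A B :: "real^'n^'n"
  assumes A: "A \<in> sym_mats" "\<And>x. x \<in> S \<Longrightarrow> A *v x \<in> S"
    and B: "B \<in> sym_mats" "\<And>x. x \<in> S \<Longrightarrow> B *v x \<in> S"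
    and comm: "A ** B = B ** A" and S: "subspace S" "S \<noteq> {0}"
  obtains v a b where "v \<in> S" "norm v = 1" "A *v v = a *\<^sub>R v" "B *v v = b *\<^sub>R v"
proof -
  obtain u a where u: "u \<in> S" "norm u = 1" "A *v u = a *\<^sub>R u"
    using sym_eigenvector[OF A(1) S(1) A(2) S(2)] by blast
  define E where "E = {x \<in> S. A *v x = a *\<^sub>R x}"
  have "subspace E"
    using S(1) by (auto simp: E_def subspace_def matrix_vector_right_distrib matrix_vector_mult_scaleR
        scaleR_add_right)
  moreover have "B *v x \<in> E" if "x \<in> E" for x
  proof -
    have "A *v (B *v x) = B *v (A *v x)"
      by (simp add: matrix_vector_mul_assoc comm)
    then show ?thesis
      using that B(2) by (auto simp: E_def matrix_vector_mult_scaleR)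
  qed
  moreover have "u \<in> E" "u \<noteq> 0"
    using u by (auto simp: E_def)
  ultimately obtain v b where "v \<in> E" "norm v = 1" "B *v v = b *\<^sub>R v"
    using sym_eigenvector[OF B(1), of E] by blast
  then show ?thesis
    using that unfolding E_def by blast
qed

text \<open>Induction on the dimension: split off a common unit eigenvector and continue in its
  orthogonal complement within \<open>S\<close>.\<close>

lemma common_eigenbasis_subspace:
  fixes A B :: "real^'n^'n"
  assumes A: "A \<in> sym_mats" and B: "B \<in> sym_mats" and comm: "A ** B = B ** A"
  assumes "subspace S" "\<And>x. x \<in> S \<Longrightarrow> A *v x \<in> S" "\<And>x. x \<in> S \<Longrightarrow> B *v x \<in> S"
  shows "\<exists>T. finite T \<and> card T = dim S \<and> T \<subseteq> S \<and> pairwise orthogonal T \<and>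
    (\<forall>v\<in>T. norm v = 1 \<and> (\<exists>a. A *v v = a *\<^sub>R v) \<and> (\<exists>b. B *v v = b *\<^sub>R v))"
  using assms(4-)
proof (induction "dim S" arbitrary: S)
  case 0
  then show ?case
    by (intro exI[of _ "{}"]) auto
next
  case (Suc k S)
  have "S \<noteq> {0}"
    using Suc.hyps(2) by auto
  then obtain v a b where v: "v \<in> S" "norm v = 1" "A *v v = a *\<^sub>R v" "B *v v = b *\<^sub>R v"
    using common_eigenvector[OF A Suc.prems(2) B Suc.prems(3) comm Suc.prems(1)] by blast
  define S' where "S' = {x \<in> S. v \<bullet> x = 0}"
  have sub: "subspace S'"
    using Suc.prems(1) by (auto simp: S'_def subspace_def inner_add_right)
  \<comment> \<open>Symmetry moves \<open>C\<close> onto its eigenvector \<open>v\<close>, so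
    orthogonality to \<open>v\<close> is preserved.\<close>
  have inv: "C *v x \<in> S'"
    if "C \<in> sym_mats" "C *v v = c *\<^sub>R v" "\<And>x. x \<in> S \<Longrightarrow> C *v x \<in> S" "x \<in> S'" for C c x
    using that sym_dot[of C v x] by (auto simp: S'_def)
  have "S' = {y \<in> S. \<forall>x\<in>span {v}. orthogonal x y}"
    by (auto simp: S'_def span_singleton orthogonal_def intro: exI[of _ "1 :: real"])
  moreover have "span {v} \<subseteq> S"
    using v(1) Suc.prems(1) by (simp add: span_minimal)
  moreover have "dim (span {v}) = 1"
    using v(2) by (auto simp: dim_singleton)
  ultimately have "dim S' + 1 = dim S"
    using dim_subspace_orthogonal_to_vectors[of "span {v}" S] Suc.prems(1) by simp
  then have "k = dim S'"
    using Suc.hyps(2) by simp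
  from Suc.hyps(1)[OF this sub inv[OF A v(3) Suc.prems(2)] inv[OF B v(4) Suc.prems(3)]]
  obtain T where T: "finite T" "card T = dim S'" "T \<subseteq> S'" "pairwise orthogonal T"
    "\<forall>v\<in>T. norm v = 1 \<and> (\<exists>a. A *v v = a *\<^sub>R v) \<and> (\<exists>b. B *v v = b *\<^sub>R v)"
    by auto
  have "v \<notin> T"
    using T(3) v(2) by (auto simp: S'_def norm_eq_1)
  moreover have "pairwise orthogonal (insert v T)"
    using T(3,4) by (auto simp: pairwise_insert S'_def orthogonal_def inner_commute)
  ultimately show ?case
    using T v \<open>dim S' + 1 = dim S\<close>
    by (intro exI[of _ "insert v T"]) (auto simp: S'_def)
qed

text \<open>The orthonormal basis is indexed by \<open>'n\<close> and becomes the columns of one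
  \<open>V\<close>, so the entries of \<open>a\<close> and \<open>b\<close> are paired by
  eigenvector.\<close>

lemma common_eigensystem:
  fixes A B :: "real^'n^'n"
  assumes "A \<in> sym_mats" "B \<in> sym_mats" "A ** B = B ** A"
  obtains V a b where "eigensystem A V a" "eigensystem B V b"
proof -
  obtain T :: "(real^'n) set" where T: "finite T" "card T = CARD('n)" "pairwise orthogonal T"
    "\<forall>v\<in>T. norm v = 1 \<and> (\<exists>a. A *v v = a *\<^sub>R v) \<and> (\<exists>b. B *v v = b *\<^sub>R v)"
    using common_eigenbasis_subspace[OF assms, of UNIV] by auto
  obtain f :: "'n \<Rightarrow> real^'n" where f: "bij_betw f UNIV T"
    using finite_same_card_bij[of "UNIV :: 'n set" T] T by auto
  define V :: "real^'n^'n" where "V = (\<chi> i j. f j $ i)"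
  have col: "column j V = f j" for j
    by (simp add: column_def V_def vec_eq_iff)
  have fT: "f j \<in> T" for j
    using f by (auto simp: bij_betw_def)
  have "orthogonal (f i) (f j)" if "i \<noteq> j" for i j
  proof -
    have "f i \<noteq> f j"
      using f that by (auto simp: bij_betw_def inj_on_def)
    then show ?thesis
      using T(3) fT by (simp add: pairwise_def)
  qed
  then have "orthogonal_matrix V"
    using T(4) fT by (simp add: orthogonal_matrix_orthonormal_columns col)
  moreover have "\<forall>j. \<exists>a. A *v f j = a *\<^sub>R f j" "\<forall>j. \<exists>b. B *v f j = b *\<^sub>R f j"
    using T(4) fT by blast+
  then obtain a b where "\<And>j. A *v f j = a j *\<^sub>R f j" "\<And>j. B *v f j = b j *\<^sub>R f j"
    unfolding choice_iff by blast
  ultimately have "eigensystem A V (vec_lambda a)" "eigensystem B V (vec_lambda b)"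
    by (simp_all add: eigensystem_def col)
  then show ?thesis
    by (rule that)
qed

section \<open>Spectral decompositions\<close>

lemma diag_mat_mult_vec: "diag_mat d *v x = (\<chi> i. d $ i * x $ i)"
  by (simp add: diag_mat_def matrix_vector_mult_def vec_eq_iff if_distrib[of "\<lambda>c. c * _"] cong: if_cong)

lemma transpose_diag_mat [simp]: "transpose (diag_mat d) = diag_mat d"
  by (simp add: diag_mat_def transpose_def vec_eq_iff)

lemma diag_mat_mult: "(diag_mat d ** B) $ i $ j = d $ i * B $ i $ j"
  by (simp add: diag_mat_def matrix_matrix_mult_def if_distrib[of "\<lambda>c. c * _"] cong: if_cong)

lemma spectral_mult_vec:
  fixes V :: "real^'n^'n"
  shows "(V ** diag_mat d ** transpose V) *v x = (\<Sum>j\<in>UNIV. (d $ j * (column j V \<bullet> x)) *\<^sub>R column j V)"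
proof -
  have "transpose V *v x = (\<chi> j. column j V \<bullet> x)"
    by (simp add: matrix_vector_mult_def transpose_def column_def inner_vec_def)
  then have "(V ** diag_mat d ** transpose V) *v x = V *v (\<chi> j. d $ j * (column j V \<bullet> x))"
    by (simp add: diag_mat_mult_vec flip: matrix_vector_mul_assoc)
  then show ?thesis
    by (simp add: matrix_mult_sum scalar_mult_eq_scaleR)
qed

lemma spectral_sym:
  fixes V :: "real^'n^'n"
  shows "V ** diag_mat d ** transpose V \<in> sym_mats"
  by (simp add: sym_mats_def matrix_transpose_mul matrix_mul_assoc)

lemma orthonormal_column_dot:
  fixes V :: "real^'n^'n"
  assumes "orthogonal_matrix V"
  shows "column i V \<bullet> column j V = (if i = j then 1 else 0)"
  using assms by (auto simp: orthogonal_matrix_orthonormal_columns norm_eq_1 orthogonal_def)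

lemma eigensystem_spectral:
  assumes "orthogonal_matrix V"
  shows "eigensystem (V ** diag_mat d ** transpose V) V d"
  using assms
  by (simp add: eigensystem_def spectral_mult_vec orthonormal_column_dot
      if_distrib[of "\<lambda>c. _ * c"] if_distrib[of "\<lambda>c. c *\<^sub>R _"] cong: if_cong)

text \<open>Agreement on the columns says \<open>A ** V = B ** V\<close>, and \<open>V\<close>
  cancels because it is orthogonal.\<close>

lemma matrix_eq_columnsI:
  fixes A B :: "real^'n^'n"
  assumes V: "orthogonal_matrix V" and "\<And>i. A *v column i V = B *v column i V"
  shows "A = B"
proof -
  have "A ** V = B ** V"
    using assms(2) by (simp add: vec_eq_iff matrix_matrix_mult_def matrix_vector_mult_def column_def)
  then have "A ** (V ** transpose V) = B ** (V ** transpose V)"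
    by (simp add: matrix_mul_assoc)
  then show ?thesis
    using V by (simp add: orthogonal_matrix_def)
qed

lemma eigensystem_decomp:
  assumes "eigensystem X V l"
  shows "X = V ** diag_mat l ** transpose V"
proof (rule matrix_eq_columnsI)
  show V: "orthogonal_matrix V"
    using assms by (simp add: eigensystem_def)
  show "X *v column i V = (V ** diag_mat l ** transpose V) *v column i V" for i
    using assms eigensystem_spectral[OF V] by (simp add: eigensystem_def)
qed

lemma eigensystem_diff_mat:
  assumes "eigensystem W V w"
  shows "eigensystem (mat k - W) V (\<chi> i. k - w $ i)"
  using assms
  by (simp add: eigensystem_def matrix_vector_mult_diff_rdistrib mat_mult_vec scaleR_diff_left)

section \<open>Positive semidefiniteness and complementarity in an eigenbasis\<close>

lemma eigenvalue_ge_0: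
  assumes "psd X" "X *v v = l *\<^sub>R v" "norm v = 1"
  shows "0 \<le> l"
proof -
  have "0 \<le> v \<bullet> (X *v v)"
    using assms(1) by (simp add: psd_def)
  then show ?thesis
    using assms by (simp add: dot_square_norm)
qed

lemma eigensystem_ge_0:
  assumes "psd X" "eigensystem X V l"
  shows "0 \<le> l $ i"
  using eigenvalue_ge_0[OF assms(1), of "column i V"] assms(2)
  by (simp add: eigensystem_def orthogonal_matrix_orthonormal_columns)

lemma psd_spectralI:
  fixes V :: "real^'n^'n"
  assumes "\<And>i. 0 \<le> d $ i"
  shows "psd (V ** diag_mat d ** transpose V)"
proof -
  have "x \<bullet> ((V ** diag_mat d ** transpose V) *v x) = (\<Sum>j\<in>UNIV. d $ j * (column j V \<bullet> x)\<^sup>2)" for x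
    by (simp add: spectral_mult_vec inner_sum_right power2_eq_square inner_commute mult.assoc)
  then show ?thesis
    using assms by (simp add: psd_def spectral_sym sum_nonneg)
qed

text \<open>Cyclicity of the trace moves \<open>V\<close> to the right, leaving the diagonal of
  \<open>transpose V ** B ** V\<close> weighted by \<open>d\<close>.\<close>

lemma inner_spectral:
  fixes V B :: "real^'n^'n"
  shows "(V ** diag_mat d ** transpose V) \<bullet> B = (\<Sum>j\<in>UNIV. d $ j * (column j V \<bullet> (B *v column j V)))"
proof -
  have "(V ** diag_mat d ** transpose V) \<bullet> B = trace (V ** (diag_mat d ** transpose V ** B))"
    by (simp add: inner_eq_trace[OF spectral_sym] matrix_mul_assoc)
  also have "\<dots> = trace (diag_mat d ** (transpose V ** B ** V))"
    by (subst trace_mul_sym) (simp add: matrix_mul_assoc)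
  also have "\<dots> = (\<Sum>j\<in>UNIV. d $ j * (transpose V ** (B ** V)) $ j $ j)"
    by (simp add: trace_def diag_mat_mult flip: matrix_mul_assoc)
  also have "\<dots> = (\<Sum>j\<in>UNIV. d $ j * (column j V \<bullet> (B *v column j V)))"
    by (simp add: matrix_matrix_mult_def transpose_def column_def inner_vec_def matrix_vector_mult_def)
  finally show ?thesis .
qed

text \<open>In an eigenbasis of \<open>A\<close> the inner product is a sum of nonnegative terms, so
  each is zero. Hence the form of \<open>B\<close>, and with it \<open>B\<close>, vanishes on the
  eigenvectors with nonzero eigenvalue.\<close>

lemma psd_compl_mult_eq_0:
  fixes A B :: "real^'n^'n"
  assumes "psd_compl A B" "eigensystem A V l"
  shows "B ** A = 0"
proof (rule matrix_eq_columnsI)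
  have A: "psd A" and B: "psd B" and "A \<bullet> B = 0"
    using assms by (auto simp: psd_compl_def)
  show V: "orthogonal_matrix V"
    using assms by (simp add: eigensystem_def)
  have "(\<Sum>j\<in>UNIV. l $ j * (column j V \<bullet> (B *v column j V))) = 0"
    using \<open>A \<bullet> B = 0\<close> inner_spectral[of V l B] by (simp flip: eigensystem_decomp[OF assms(2)])
  then have *: "l $ j * (column j V \<bullet> (B *v column j V)) = 0" for j
    using eigensystem_ge_0[OF A assms(2)] B by (subst (asm) sum_nonneg_eq_0_iff) (auto simp: psd_def)
  have "l $ j *\<^sub>R (B *v column j V) = 0" for j
    using *[of j] psd_on_form_eq_0[of B UNIV "column j V"] B by (auto simp: psd_def)
  then show "(B ** A) *v column j V = 0 *v column j V" for j
    using assms(2)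
    by (simp add: eigensystem_def matrix_vector_mul_assoc[symmetric] matrix_vector_mult_scaleR)
qed

text \<open>Eigenvectors of \<open>W\<close> in the column basis only involve columns with the same eigenvalue.\<close>

lemma eigensystem_quadratic_form_in:
  assumes W: "eigensystem W V w" "W \<in> sym_mats" and v: "W *v v = \<omega> *\<^sub>R v" "norm v = 1"
    and C: "convex C" "\<And>j. w $ j = \<omega> \<Longrightarrow> d $ j \<in> C"
  shows "v \<bullet> ((V ** diag_mat d ** transpose V) *v v) \<in> C"
proof -
  define c where "c j = (column j V \<bullet> v)\<^sup>2" for j
  have V: "orthogonal_matrix V"
    using W by (simp add: eigensystem_def)
  have eq: "v \<bullet> ((V ** diag_mat e ** transpose V) *v v) = (\<Sum>j\<in>UNIV. c j * e $ j)" for e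
    by (simp add: spectral_mult_vec inner_sum_right c_def power2_eq_square inner_commute mult_ac)
  have "w $ j = \<omega>" if "c j \<noteq> 0" for j
  proof -
    \<comment> \<open>Eigenvectors of a symmetric matrix for different eigenvalues are
      orthogonal.\<close>
    have "(W *v column j V) \<bullet> v = column j V \<bullet> (W *v v)"
      using sym_dot[OF W(2)] .
    then have "w $ j * (column j V \<bullet> v) = \<omega> * (column j V \<bullet> v)"
      using W(1) v(1) by (simp add: eigensystem_def)
    then show ?thesis
      using that by (simp add: c_def)
  qed
  then have d: "d $ j \<in> C" if "c j \<noteq> 0" for j
    using that C(2) by blast
  \<comment> \<open>Parseval's identity: the form of the identity matrix at the unit vector
    \<open>v\<close> shows that the weights \<open>c\<close> sum to \<open>1\<close>.\<close>
  have "eigensystem (mat 1) V (\<chi> i. 1)"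
    using V by (simp add: eigensystem_def)
  then have "mat 1 = V ** diag_mat (\<chi> i. 1) ** transpose V"
    by (rule eigensystem_decomp)
  from eq[of "\<chi> i. 1", folded this] have sum1: "(\<Sum>j\<in>UNIV. c j) = 1"
    using v(2) by (simp add: dot_square_norm)
  \<comment> \<open>Membership of \<open>d $ j\<close> in \<open>C\<close> is known only where the
    weight is nonzero, so the convex combination runs over those indices.\<close>
  have restrict: "(\<Sum>j | c j \<noteq> 0. f j) = (\<Sum>j\<in>UNIV. f j)" if "\<And>j. c j = 0 \<Longrightarrow> f j = 0" for f :: "_ \<Rightarrow> real"
    using that by (intro sum.mono_neutral_left) auto
  have "(\<Sum>j | c j \<noteq> 0. c j *\<^sub>R d $ j) \<in> C"
  proof (rule convex_sum)
    show "(\<Sum>j | c j \<noteq> 0. c j) = 1"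
      using restrict[of c] sum1 by simp
    show "0 \<le> c j" for j
      by (simp add: c_def)
    show "d $ j \<in> C" if "j \<in> {j. c j \<noteq> 0}" for j
      using d that by simp
  qed (simp_all add: C)
  then have "(\<Sum>j\<in>UNIV. c j * d $ j) \<in> C"
    using restrict[of "\<lambda>j. c j * d $ j"] by simp
  then show ?thesis
    by (simp add: eq)
qed

section \<open>Equivalence of the KKT conditions\<close>

text \<open>\<open>U\<close> and \<open>X\<close> share the eigenvector matrix \<open>V\<close>, so
  the inclusion reduces to the scalar relation \<open>g_subdiff\<close>. It applies since
  \<open>bounds\<close> keeps the eigenvalues of \<open>U\<close> in
  \<open>[0, \<kappa>]\<close>.\<close>

lemma minus_in_subdiff_G_and_bounds:
  fixes X U :: "real^'n^'n"
  assumes X: "psd X" and U: "U \<in> subdiff_rho_mat \<rho> \<kappa> X"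
    and bounds: "\<And>x w. 0 \<le> x \<Longrightarrow> w \<in> subdiff_rho \<rho> \<kappa> x \<Longrightarrow> 0 \<le> w \<and> w \<le> \<kappa>"
    and g_subdiff: "\<And>w. 0 \<le> w \<Longrightarrow> w \<le> \<kappa> \<Longrightarrow>
      subdiff g w = {- x | x. x \<ge> 0 \<and> w \<in> subdiff_rho \<rho> \<kappa> x}"
  shows "- X \<in> subdiff_G g U" "psd U" "psd (mat \<kappa> - U)"
proof -
  obtain V y l where U_eq: "U = V ** diag_mat y ** transpose V" and l: "eigensystem X V l"
    and y: "\<And>i. y $ i \<in> subdiff_rho \<rho> \<kappa> (l $ i)"
    using U unfolding subdiff_rho_mat_def spectral_set_def by blast
  have l0: "0 \<le> l $ i" for i
    using eigensystem_ge_0[OF X l] .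
  have y01: "0 \<le> y $ i" "y $ i \<le> \<kappa>" for i
    using bounds[OF l0 y] by auto
  have "orthogonal_matrix V"
    using l by (simp add: eigensystem_def)
  then have Uy: "eigensystem U V y"
    unfolding U_eq by (rule eigensystem_spectral)
  have "eigensystem (- X) V (- l)"
    using l matrix_vector_mult_diff_rdistrib[of 0 X] by (simp add: eigensystem_def)
  then have "- X = V ** diag_mat (- l) ** transpose V"
    by (rule eigensystem_decomp)
  moreover have "(- l) $ i \<in> subdiff g (y $ i)" for i
    using g_subdiff[OF y01] l0 y by auto
  ultimately show "- X \<in> subdiff_G g U"
    unfolding subdiff_G_def spectral_set_def using Uy by blast
  show "psd U"
    unfolding U_eq using y01(1) by (rule psd_spectralI)
  show "psd (mat \<kappa> - U)"
    unfolding eigensystem_decomp[OF eigensystem_diff_mat[OF Uy, of \<kappa>]]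
    using y01(2) by (intro psd_spectralI) simp
qed

text \<open>Membership of \<open>W\<close> here lets \<open>W\<close> itself act as the subgradient
  in the KKT condition of (P).\<close>

lemma subdiff_rho_mat_if_kkt_B:
  fixes X W Y Z :: "real^'n^'n"
  assumes \<rho>: "concave_on {0..} \<rho>" "\<And>w x. w \<le> \<kappa> \<Longrightarrow> w \<in> subdiff_rho \<rho> \<kappa> x \<longleftrightarrow> w \<in> superdiff \<rho> x"
    and up: "\<And>x x'. 0 \<in> superdiff \<rho> x \<Longrightarrow> 0 \<le> x \<Longrightarrow> x \<le> x' \<Longrightarrow> 0 \<in> superdiff \<rho> x'"
    and down: "\<And>x x'. \<kappa> \<in> superdiff \<rho> x \<Longrightarrow> 0 \<le> x' \<Longrightarrow> x' \<le> x \<Longrightarrow> \<kappa> \<in> superdiff \<rho> x'"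
    and g_subdiff: "\<And>w. 0 \<le> w \<Longrightarrow> w \<le> \<kappa> \<Longrightarrow>
      subdiff g w = {- x | x. x \<ge> 0 \<and> w \<in> subdiff_rho \<rho> \<kappa> x}"
    and X: "psd X" and Z: "Z \<in> subdiff_G g W"
    and WM: "psd_compl W (X + Z + Y)" and YW: "psd_compl Y (mat \<kappa> - W)"
  shows "W \<in> subdiff_rho_mat \<rho> \<kappa> X"
proof -
  obtain V z w where Z_eq: "Z = V ** diag_mat z ** transpose V" and w: "eigensystem W V w"
    and z: "\<And>i. z $ i \<in> subdiff g (w $ i)"
    using Z unfolding subdiff_G_def spectral_set_def by blast
  define M where "M = X + Z + Y"
  have psds: "psd W" "psd M" "psd Y" "psd (mat \<kappa> - W)"
    using WM YW by (auto simp: psd_compl_def M_def)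
  then have syms: "X \<in> sym_mats" "W \<in> sym_mats" "M \<in> sym_mats" "Y \<in> sym_mats" "Z \<in> sym_mats"
    using X spectral_sym by (auto simp: psd_def Z_eq)
  have w01: "0 \<le> w $ i" "w $ i \<le> \<kappa>" for i
    using eigensystem_ge_0[OF psds(1) w] eigensystem_ge_0[OF psds(4) eigensystem_diff_mat[OF w], of i] by auto
  have superd: "0 \<le> - z $ i" "w $ i \<in> superdiff \<rho> (- z $ i)" for i
    using z[of i] g_subdiff[OF w01] \<rho>(2)[OF w01(2)] by auto

  have MW: "M ** W = 0"
    using psd_compl_mult_eq_0[OF WM w] by (simp add: M_def)
  \<comment> \<open>The roles are swapped because the known eigensystem is that of
    \<open>mat \<kappa> - W\<close>, inherited from \<open>W\<close>.\<close>
  have "psd_compl (mat \<kappa> - W) Y"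
    using YW by (simp add: psd_compl_def inner_commute)
  then have YK: "Y ** (mat \<kappa> - W) = 0"
    using psd_compl_mult_eq_0 eigensystem_diff_mat[OF w] by blast
  have Yv: "\<kappa> *\<^sub>R (Y *v v) = Y *v (W *v v)" for v
  proof -
    have "Y *v ((mat \<kappa> - W) *v v) = 0"
      by (simp add: matrix_vector_mul_assoc YK)
    then show ?thesis
      by (simp add: matrix_vector_mult_diff_rdistrib matrix_vector_mult_diff_distrib mat_mult_vec matrix_vector_mult_scaleR)
  qed
  have MWv: "M *v (W *v v) = 0" for v
    by (simp add: matrix_vector_mul_assoc MW)

  have "Z ** W = W ** Z"
  proof (rule matrix_eq_columnsI)
    show V: "orthogonal_matrix V"
      using w by (simp add: eigensystem_def)
    show "(Z ** W) *v column i V = (W ** Z) *v column i V" for i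
      using w eigensystem_spectral[OF V, of z] unfolding Z_eq[symmetric]
      by (simp add: eigensystem_def matrix_vector_mul_assoc[symmetric] matrix_vector_mult_scaleR mult.commute)
  qed
  moreover have "M ** W = W ** M"
  proof -
    have "W ** M = transpose (M ** W)"
      using syms by (simp add: matrix_transpose_mul sym_mats_def)
    also have "\<dots> = 0"
      by (simp add: MW transpose_def vec_eq_iff)
    finally show ?thesis
      by (simp add: MW)
  qed
  moreover have "Y ** W = W ** Y"
  proof -
    have *: "Y ** W = \<kappa> *\<^sub>R Y"
      using Yv by (simp add: matrix_eq matrix_vector_mul_assoc[symmetric] scaleR_matrix_vector_assoc[symmetric])
    have "W ** Y = transpose (Y ** W)"
      using syms by (simp add: matrix_transpose_mul sym_mats_def)
    also have "\<dots> = \<kappa> *\<^sub>R Y"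
      unfolding * using syms(4) by (simp add: sym_mats_def transpose_def vec_eq_iff)
    finally show ?thesis
      by (simp add: *)
  qed
  moreover have X_eq: "X = M - Z - Y"
    by (simp add: M_def)
  ultimately have "X ** W = W ** X"
    by (simp add: matrix_eq matrix_vector_mult_diff_distrib matrix_vector_mult_diff_rdistrib flip: matrix_vector_mul_assoc)
  \<comment> \<open>\<open>V'\<close> may differ from \<open>V\<close> within eigenspaces of
    \<open>W\<close>, and \<open>Z\<close> need not be diagonal in it. Hence only the quadratic form
    of \<open>Z\<close> at the columns of \<open>V'\<close> is used below.\<close>
  then obtain V' l \<omega> where l: "eigensystem X V' l" and \<omega>: "eigensystem W V' \<omega>"
    using common_eigensystem syms by metis
  have "\<omega> $ i \<in> subdiff_rho \<rho> \<kappa> (l $ i)" for i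
  proof -
    define v where "v = column i V'"
    have v: "norm v = 1" "X *v v = l $ i *\<^sub>R v" "W *v v = \<omega> $ i *\<^sub>R v"
      using l \<omega> by (auto simp: eigensystem_def v_def orthogonal_matrix_orthonormal_columns)
    define d where "d = - (v \<bullet> (Z *v v))"
    define m where "m = v \<bullet> (M *v v)"
    define y where "y = v \<bullet> (Y *v v)"
    have "l $ i = v \<bullet> (X *v v)"
      using v by (simp add: dot_square_norm)
    also have "\<dots> = d + m - y"
      by (simp add: X_eq d_def m_def y_def matrix_vector_mult_diff_rdistrib inner_diff_right)
    finally have sum: "l $ i = d + m - y" .
    have my: "0 \<le> m" "0 \<le> y"
      using psds by (auto simp: m_def y_def psd_def)
    have m0: "m = 0" if "\<omega> $ i \<noteq> 0"
      using MWv[of v] v that by (simp add: m_def matrix_vector_mult_scaleR)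
    have y0: "y = 0" if "\<omega> $ i \<noteq> \<kappa>"
      using Yv[of v] v that by (simp add: y_def matrix_vector_mult_scaleR)
    define C where "C = {x. 0 \<le> x \<and> \<omega> $ i \<in> superdiff \<rho> x}"
    \<comment> \<open>The sign flip reflects that the eigenvalues of \<open>Z\<close> are negatives
      of points of the superdifferential relation.\<close>
    have "convex (uminus ` C)"
      unfolding C_def by (intro convex_negations convex_superdiff_points \<rho>)
    moreover have "z $ j \<in> uminus ` C" if "w $ j = \<omega> $ i" for j
      using superd[of j] that by (intro image_eqI[of _ _ "- z $ j"]) (auto simp: C_def)
    ultimately have "v \<bullet> (Z *v v) \<in> uminus ` C"
      unfolding Z_eq using eigensystem_quadratic_form_in[OF w syms(2) v(3,1)] by blast
    then have d: "d \<in> C"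
      by (auto simp: d_def)
    \<comment> \<open>Either \<open>m = 0\<close>, or \<open>\<omega> $ i = 0\<close> and
      \<open>C\<close> is closed upwards.\<close>
    have "d + m \<in> C"
      using d m0 my up[of d "d + m"] by (cases "\<omega> $ i = 0") (auto simp: C_def)
    moreover have "0 \<le> l $ i"
      using eigensystem_ge_0[OF X l] .
    \<comment> \<open>Either \<open>y = 0\<close>, or \<open>\<omega> $ i = \<kappa>\<close> and
      \<open>C\<close> is closed downwards as far as \<open>0\<close>. Going up before down also
      covers \<open>\<kappa> = 0\<close>, where both \<open>m\<close> and \<open>y\<close> may be
      nonzero.\<close>
    ultimately have "l $ i \<in> C"
      using y0 my down[of "d + m" "l $ i"] sum by (cases "\<omega> $ i = \<kappa>") (auto simp: C_def)
    moreover have "\<omega> $ i \<le> \<kappa>"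
      using eigensystem_ge_0[OF psds(4) eigensystem_diff_mat[OF \<omega>], of i] by simp
    ultimately show ?thesis
      using \<rho>(2) by (simp add: C_def)
  qed
  then show ?thesis
    unfolding subdiff_rho_mat_def spectral_set_def using l eigensystem_decomp[OF \<omega>] by blast
qed

theorem proposition1:
  fixes \<rho> :: "real \<Rightarrow> real" and \<kappa> L :: real and g :: "real \<Rightarrow> ereal"
    and \<A> :: "real^'n^'n \<Rightarrow> real^'m" and A :: "'m \<Rightarrow> real^'n^'n" and b :: "real^'m"
    and \<phi> :: "real^'n^'n \<Rightarrow> real"
  assumes rho_nonneg: "\<And>x. x \<ge> 0 \<Longrightarrow> \<rho> x \<ge> 0"
    and rho_concave: "concave_on {0..} \<rho>"
    and rho_mono: "mono_on {0..} \<rho>"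
    and rho_zero: "\<rho> 0 = 0"
    and rho_finite_subgradients: "\<And>x. x \<ge> 0 \<Longrightarrow> superdiff \<rho> x \<noteq> {}"
    and kappa: "((\<lambda>x. Sup (superdiff \<rho> x)) \<longlongrightarrow> \<kappa>) (at_right 0)"
    and A_linear: "linear \<A>"
    and A_sym: "\<And>i. A i \<in> sym_mats"
    and A_repr: "\<And>X i. X \<in> sym_mats \<Longrightarrow> \<A> X $ i = A i \<bullet> X"
    and phi_smooth: "L_smooth L \<phi>"
    and g_convex: "convex_ereal g"
    and g_subdiff: "\<And>w. 0 \<le> w \<Longrightarrow> w \<le> \<kappa> \<Longrightarrow>
           subdiff g w = {- x | x. x \<ge> 0 \<and> w \<in> subdiff_rho \<rho> \<kappa> x}"
  shows "(\<forall>X. kkt_P \<rho> \<kappa> \<A> A b \<phi> X \<longrightarrow>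
             (\<exists>W. kkt_B g \<kappa> \<A> A b \<phi> X W \<and> W \<in> subdiff_rho_mat \<rho> \<kappa> X))
       \<and> (\<forall>X W. kkt_B g \<kappa> \<A> A b \<phi> X W \<longrightarrow>
             kkt_P \<rho> \<kappa> \<A> A b \<phi> X \<and> W \<in> subdiff_rho_mat \<rho> \<kappa> X)"
proof (intro conjI allI impI)
  note rho = rho_nonneg rho_mono rho_zero rho_finite_subgradients kappa
  fix X :: "real^'n^'n"
  assume "kkt_P \<rho> \<kappa> \<A> A b \<phi> X"
  then obtain U \<mu> where X: "X \<in> sym_mats" "\<A> X = b"
    and U: "U \<in> subdiff_rho_mat \<rho> \<kappa> X"
    and compl: "psd_compl X ((\<Sum>i\<in>UNIV. (\<mu> :: real^'m) $ i *\<^sub>R A i) + U + sym_grad \<phi> X)"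
    unfolding kkt_P_def by blast
  have "psd X"
    using compl by (simp add: psd_compl_def)
  note UB = minus_in_subdiff_G_and_bounds[OF this U _ g_subdiff]
  have U': "- X \<in> subdiff_G g U" "psd U" "psd (mat \<kappa> - U)"
    using UB subdiff_rho_bounds[OF rho] by blast+
  have "psd (0 :: real^'n^'n)"
    by (simp add: psd_def sym_mats_def transpose_def vec_eq_iff)
  \<comment> \<open>With \<open>Z = - X\<close> and \<open>Y = 0\<close> both inner products vanish,
    so only the bounds on \<open>U\<close> remain.\<close>
  then have "psd_compl U (X + - X + 0)" "psd_compl 0 (mat \<kappa> - U)"
    using U' by (simp_all add: psd_compl_def)
  moreover have "U \<in> sym_mats" "(0 :: real^'n^'n) \<in> sym_mats"
    using U'(2) \<open>psd 0\<close> by (simp_all add: psd_def)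
  ultimately have "kkt_B g \<kappa> \<A> A b \<phi> X U"
    unfolding kkt_B_def using X U'(1) compl by blast
  with U show "\<exists>W. kkt_B g \<kappa> \<A> A b \<phi> X W \<and> W \<in> subdiff_rho_mat \<rho> \<kappa> X"
    by blast
next
  note rho = rho_nonneg rho_mono rho_zero rho_finite_subgradients kappa
  fix X W :: "real^'n^'n"
  assume "kkt_B g \<kappa> \<A> A b \<phi> X W"
  then obtain Z Y \<mu> where X: "X \<in> sym_mats" "\<A> X = b"
    and Z: "Z \<in> subdiff_G g W" "psd_compl W (X + Z + Y)" "psd_compl Y (mat \<kappa> - W)"
    and compl: "psd_compl X ((\<Sum>i\<in>UNIV. (\<mu> :: real^'m) $ i *\<^sub>R A i) + W + sym_grad \<phi> X)"
    unfolding kkt_B_def by blast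
  have "psd X"
    using compl by (simp add: psd_compl_def)
  show "W \<in> subdiff_rho_mat \<rho> \<kappa> X"
  proof (rule subdiff_rho_mat_if_kkt_B[OF rho_concave _ _ _ g_subdiff \<open>psd X\<close> Z])
    show "w \<in> subdiff_rho \<rho> \<kappa> x \<longleftrightarrow> w \<in> superdiff \<rho> x" if "w \<le> \<kappa>" for w x
      by (rule subdiff_rho_iff_superdiff[OF rho that])
    show "0 \<in> superdiff \<rho> x'" if "0 \<in> superdiff \<rho> x" "0 \<le> x" "x \<le> x'" for x x'
      by (rule zero_in_superdiff_up[OF rho that])
    show "\<kappa> \<in> superdiff \<rho> x'" if "\<kappa> \<in> superdiff \<rho> x" "0 \<le> x'" "x' \<le> x" for x x'
      by (rule kappa_in_superdiff_down[OF rho rho_concave that])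
  qed
  \<comment> \<open>The subgradient is \<open>W\<close>, and the multiplier \<open>\<mu>\<close> is
    kept.\<close>
  then show "kkt_P \<rho> \<kappa> \<A> A b \<phi> X"
    unfolding kkt_P_def using X compl by blast
qed

end
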